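(* Let $l$ be a complete lattice which is a de Morgan algebra with residual implication. Let $TS=(S,Act,\to,I,AP,L)$ be an mv-transition system without terminal states, let $P:(2^{AP})^{\omega}\to l$ be a safety property, and let $\mathcal A=(Q,2^{AP},\delta,q_0,F)$ be an $l$-valued deterministic finite automaton with $L(\mathcal A)=\mathrm{GPref}(P)$. Then the following are equivalent: (1) $TS\models P$; (2) $\mathrm{Traces}_{fin}(TS)\subseteq L(\mathcal A)$; (3) $TS\otimes\mathcal A\models \mathrm{inv}(\varphi)$, where $\varphi=\bigvee_{q\in Q}(F(q)\wedge q)$ is an mv-proposition formula over the atomic propositions $Q$.
   Context: $l$: complete distributive lattice with $x\wedge\bigvee a_i=\bigvee(x\wedge a_i)$, order-reversing involution $\neg$, implication $a\to b=\bigvee\{c:a\wedge c\le b\}$. An mv-TS is $(S,Act,\to,I,AP,L)$ with finite $S,Act,AP$, transition map $\eta:S\times Act\times S\to l$, $I:S\to l$, $L:S\to2^{AP}$; it has no terminal states if for each $s$ there are $\alpha,s'$ with $\eta(s,\alpha,s')>0$. For an execution $\rho=s_0\alpha_1s_1\cdots$, $v(\rho)=I(s_0)\wedge\bigwedge_i\eta(s_i,\alpha_{i+1},s_{i+1})$; $\mathrm{Traces}(TS)(\sigma)=\bigvee\{v(\rho):L(s_0)L(s_1)\cdots=\sigma\}$; $\mathrm{Traces}_{fin}(TS)(\theta)=\bigvee_{\tau}\mathrm{Traces}(TS)(\theta\tau)$; $TS\models P$ iff $\mathrm{Traces}(TS)\le P$ pointwise. $\mathrm{GPref}(P)(\theta)=\bigvee_\tau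 P(\theta\tau)$; $P$ is safety if $\bigwedge_{\theta\in\mathrm{Pref}(\sigma)}\mathrm{GPref}(P)(\theta)\le P(\sigma)$ for all $\sigma$ ($\mathrm{Pref}(\sigma)$ = finite prefixes). An $l$-VDFA $(Q,\Sigma,\delta,q_0,F)$ has finite $Q$, $\delta:Q\times\Sigma\to Q$, $q_0\in Q$, $F:Q\to l$; $L(\mathcal A)(\sigma_1\cdots\sigma_k)=F(q_k)$ where $q_{i+1}=\delta(q_i,\sigma_{i+1})$. The product $TS\otimes\mathcal A=(S\times Q,Act,\to',I',Q,L')$ has $\eta'((s,q),\alpha,(t,p))=\eta(s,\alpha,t)$ if $\delta(q,L(t))=p$ and $0$ otherwise; $I'(s,q)=I(s)$ if $\delta(q_0,L(s))=q$ and $0$ otherwise; $L'(s,q)=\{q\}$. mv-proposition formulas over a set $AP'$: $\psi::=A\mid r\mid\psi\vee\psi\mid\psi\to\psi\mid\neg\psi$ ($A\in AP'$, $r\in l$, $\psi_1\wedge\psi_2:=\neg(\neg\psi_1\vee\neg\psi_2)$); $\psi(\Phi)$ for $\Phi\subseteq AP'$ evaluates $A\mapsto1$ if $A\in\Phi$ else $0$. $\mathrm{inv}(\psi)(A_0A_1\cdots)=\bigwedge_i\psi(A_i)$. *)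

theory Defs
  imports Main "HOL-Library.Omega_Words_Fun"
begin

unbundle lattice_syntax

class complete_de_morgan = complete_lattice + distrib_lattice + uminus +
  assumes inf_Sup_distrib: "x \<sqinter> \<Squnion>A = (\<Squnion>a\<in>A. x \<sqinter> a)"
    and uminus_involutive: "- (- x) = x"
    and uminus_antitone: "x \<le> y \<Longrightarrow> - y \<le> - x"

definition residual :: "'l::complete_lattice \<Rightarrow> 'l \<Rightarrow> 'l" where
  "residual a b = \<Squnion>{c. a \<sqinter> c \<le> b}"


section \<open>Words and lattice-valued linear-time properties\<close>

text \<open>
  Finite and infinite words over an alphabet \<open>A\<close> are the elements of \<^term>\<open>lists A\<close> and
  of \<open>omega_words A\<close>. A property over the atomic propositions \<open>AP\<close> is a function on infinite
  words; only its values on \<open>omega_words (Pow AP)\<close> are meaningful.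
\<close>

definition omega_words :: "'a set \<Rightarrow> 'a word set" where
  "omega_words A = {w. range w \<subseteq> A}"

definition GPref :: "'p set \<Rightarrow> ('p set word \<Rightarrow> 'l::complete_lattice) \<Rightarrow> 'p set list \<Rightarrow> 'l" where
  "GPref AP P \<theta> = (\<Squnion>\<tau>\<in>omega_words (Pow AP). P (\<theta> \<frown> \<tau>))"

definition Pref :: "'a word \<Rightarrow> 'a list set" where
  "Pref \<sigma> = {prefix n \<sigma> | n. True}"

definition safety :: "'p set \<Rightarrow> ('p set word \<Rightarrow> 'l::complete_lattice) \<Rightarrow> bool" where
  "safety AP P \<longleftrightarrow> (\<forall>\<sigma>\<in>omega_words (Pow AP). (\<Sqinter>\<theta>\<in>Pref \<sigma>. GPref AP P \<theta>) \<le> P \<sigma>)"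


section \<open>Multi-valued transition systems\<close>

record ('s, 'act, 'p, 'l) mvts =
  states :: "'s set"
  actions :: "'act set"
  trans_val :: "'s \<Rightarrow> 'act \<Rightarrow> 's \<Rightarrow> 'l"
  init_val :: "'s \<Rightarrow> 'l"
  props :: "'p set"
  label :: "'s \<Rightarrow> 'p set"

definition is_mvts :: "('s, 'act, 'p, 'l::complete_lattice) mvts \<Rightarrow> bool" where
  "is_mvts TS \<longleftrightarrow> finite (states TS) \<and> finite (actions TS) \<and> finite (props TS) \<and>
     label TS ` states TS \<subseteq> Pow (props TS)"

definition no_terminal_states :: "('s, 'act, 'p, 'l::complete_lattice) mvts \<Rightarrow> bool" where
  "no_terminal_states TS \<longleftrightarrow>
     (\<forall>s\<in>states TS. \<exists>\<alpha>\<in>actions TS. \<exists>t\<in>states TS. trans_val TS s \<alpha> t > \<bottom>)"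

text \<open>
  The pair \<open>(s, a)\<close> encodes the alternating sequence \<open>s 0, a 0, s 1, a 1, s 2, \<dots>\<close>, so that
  \<open>a i\<close> is the action leading from \<open>s i\<close> to \<open>s (Suc i)\<close>. An execution starts in an initial
  state and follows possible transitions only, i.e. the values concerned are nonzero. Lemma
  \<open>Traces_alt\<close> below shows that this restriction does not affect \<open>Traces\<close>.
\<close>

definition executions :: "('s, 'act, 'p, 'l::complete_lattice) mvts \<Rightarrow> ('s word \<times> 'act word) set" where
  "executions TS = {(s, a). s \<in> omega_words (states TS) \<and> a \<in> omega_words (actions TS) \<and>
     init_val TS (s 0) > \<bottom> \<and> (\<forall>i. trans_val TS (s i) (a i) (s (Suc i)) > \<bottom>)}"

fun exec_val :: "('s, 'act, 'p, 'l::complete_lattice) mvts \<Rightarrow> 's word \<times> 'act word \<Rightarrow> 'l" where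
  "exec_val TS (s, a) = init_val TS (s 0) \<sqinter> (\<Sqinter>i. trans_val TS (s i) (a i) (s (Suc i)))"

definition exec_trace :: "('s, 'act, 'p, 'l) mvts \<Rightarrow> 's word \<times> 'act word \<Rightarrow> 'p set word" where
  "exec_trace TS \<rho> = label TS \<circ> fst \<rho>"

definition Traces :: "('s, 'act, 'p, 'l::complete_lattice) mvts \<Rightarrow> 'p set word \<Rightarrow> 'l" where
  "Traces TS \<sigma> = (\<Squnion>\<rho>\<in>{\<rho> \<in> executions TS. exec_trace TS \<rho> = \<sigma>}. exec_val TS \<rho>)"

definition Traces_fin :: "('s, 'act, 'p, 'l::complete_lattice) mvts \<Rightarrow> 'p set list \<Rightarrow> 'l" where
  "Traces_fin TS \<theta> = (\<Squnion>\<tau>\<in>omega_words (Pow (props TS)). Traces TS (\<theta> \<frown> \<tau>))"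

definition satisfies ::
  "('s, 'act, 'p, 'l::complete_lattice) mvts \<Rightarrow> ('p set word \<Rightarrow> 'l) \<Rightarrow> bool"  (infix \<open>\<Turnstile>\<close> 50) where
  "TS \<Turnstile> P \<longleftrightarrow> (\<forall>\<sigma>\<in>omega_words (Pow (props TS)). Traces TS \<sigma> \<le> P \<sigma>)"

lemma Traces_alt:
  "Traces TS \<sigma> =
     (\<Squnion>\<rho>\<in>{\<rho> \<in> omega_words (states TS) \<times> omega_words (actions TS). exec_trace TS \<rho> = \<sigma>}. exec_val TS \<rho>)"
  (is "_ = ?R")
proof (rule antisym)
  show "Traces TS \<sigma> \<le> ?R"
    unfolding Traces_def by (rule SUP_subset_mono) (auto simp: executions_def)
  show "?R \<le> Traces TS \<sigma>"
  proof (rule SUP_least)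
    fix \<rho> assume \<rho>: "\<rho> \<in> {\<rho> \<in> omega_words (states TS) \<times> omega_words (actions TS). exec_trace TS \<rho> = \<sigma>}"
    obtain s a where sa: "\<rho> = (s, a)" by (cases \<rho>)
    show "exec_val TS \<rho> \<le> Traces TS \<sigma>"
    proof (cases "exec_val TS \<rho> = \<bottom>")
      case False
      have "exec_val TS \<rho> \<le> init_val TS (s 0)" by (simp add: sa)
      moreover have "exec_val TS \<rho> \<le> trans_val TS (s i) (a i) (s (Suc i))" for i
        using INF_lower[of i UNIV] by (auto simp: sa intro!: le_infI2)
      moreover have "exec_val TS \<rho> > \<bottom>"
        using False by (simp add: bot.not_eq_extremum)
      ultimately have "\<rho> \<in> executions TS"
        using \<rho> less_le_trans by (auto simp: executions_def sa simp del: exec_val.simps)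
      then show ?thesis
        unfolding Traces_def using \<rho> by (auto intro: SUP_upper)
    qed simp
  qed
qed


section \<open>Lattice-valued deterministic finite automata\<close>

record ('q, 'a, 'l) vdfa =
  vstates :: "'q set"
  alphabet :: "'a set"
  delta :: "'q \<Rightarrow> 'a \<Rightarrow> 'q"
  start :: 'q
  final_val :: "'q \<Rightarrow> 'l"

definition is_vdfa :: "('q, 'a, 'l) vdfa \<Rightarrow> bool" where
  "is_vdfa A \<longleftrightarrow> finite (vstates A) \<and> start A \<in> vstates A \<and>
     (\<forall>q\<in>vstates A. \<forall>a\<in>alphabet A. delta A q a \<in> vstates A)"

definition lang :: "('q, 'a, 'l) vdfa \<Rightarrow> 'a list \<Rightarrow> 'l" where
  "lang A w = final_val A (foldl (delta A) (start A) w)"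

definition product ::
  "('s, 'act, 'p, 'l::complete_lattice) mvts \<Rightarrow> ('q, 'p set, 'l) vdfa \<Rightarrow> ('s \<times> 'q, 'act, 'q, 'l) mvts"
  (infixl \<open>\<otimes>\<close> 70) where
  "TS \<otimes> A = \<lparr>
     states = states TS \<times> vstates A,
     actions = actions TS,
     trans_val = (\<lambda>(s, q) \<alpha> (t, p). if delta A q (label TS t) = p then trans_val TS s \<alpha> t else \<bottom>),
     init_val = (\<lambda>(s, q). if delta A (start A) (label TS s) = q then init_val TS s else \<bottom>),
     props = vstates A,
     label = (\<lambda>(s, q). {q})\<rparr>"


section \<open>Multi-valued proposition formulas\<close>

datatype ('p, 'l) mvform =
    Atom 'p
  | Const 'l
  | Or "('p, 'l) mvform" "('p, 'l) mvform"
  | Imp "('p, 'l) mvform" "('p, 'l) mvform"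
  | Neg "('p, 'l) mvform"

definition And :: "('p, 'l) mvform \<Rightarrow> ('p, 'l) mvform \<Rightarrow> ('p, 'l) mvform" where
  "And \<psi>\<^sub>1 \<psi>\<^sub>2 = Neg (Or (Neg \<psi>\<^sub>1) (Neg \<psi>\<^sub>2))"

text \<open>The clause for the empty list is a convention; the state set of an automaton is never empty.\<close>

fun BigOr :: "('p, 'l::complete_lattice) mvform list \<Rightarrow> ('p, 'l) mvform" where
  "BigOr [] = Const \<bottom>"
| "BigOr [\<psi>] = \<psi>"
| "BigOr (\<psi> # \<psi>' # \<psi>s) = Or \<psi> (BigOr (\<psi>' # \<psi>s))"

fun form_val :: "('p, 'l::complete_de_morgan) mvform \<Rightarrow> 'p set \<Rightarrow> 'l" where
  "form_val (Atom A) \<Phi> = (if A \<in> \<Phi> then \<top> else \<bottom>)"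
| "form_val (Const r) \<Phi> = r"
| "form_val (Or \<psi>\<^sub>1 \<psi>\<^sub>2) \<Phi> = form_val \<psi>\<^sub>1 \<Phi> \<squnion> form_val \<psi>\<^sub>2 \<Phi>"
| "form_val (Imp \<psi>\<^sub>1 \<psi>\<^sub>2) \<Phi> = residual (form_val \<psi>\<^sub>1 \<Phi>) (form_val \<psi>\<^sub>2 \<Phi>)"
| "form_val (Neg \<psi>) \<Phi> = - form_val \<psi> \<Phi>"

definition inv_prop :: "('p, 'l::complete_de_morgan) mvform \<Rightarrow> 'p set word \<Rightarrow> 'l" where
  "inv_prop \<psi> \<sigma> = (\<Sqinter>i. form_val \<psi> (\<sigma> i))"

text \<open>
  The formula \<open>\<Or>q\<in>Q. F q \<and> q\<close>, where the list \<open>qs\<close> enumerates the finite set \<open>Q\<close> and thereby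
  fixes the order of the disjuncts.
\<close>

definition final_form :: "('q \<Rightarrow> 'l::complete_lattice) \<Rightarrow> 'q list \<Rightarrow> ('q, 'l) mvform" where
  "final_form F qs = BigOr (map (\<lambda>q. And (Const (F q)) (Atom q)) qs)"

end

theory Submission
  imports Defs
begin

text \<open>
  The automaton is deterministic, so every execution \<open>s\<close> of \<open>TS\<close> lifts to exactly one execution of the
  product, whose automaton component at time \<open>i\<close> is the state reached on
  \<open>L(s 0) \<dots> L(s i)\<close>; the lift preserves the value, and \<open>\<phi>\<close> evaluates there to
  \<open>GPref(P)(L(s 0) \<dots> L(s i))\<close>. The product never observes the empty word, but \<open>GPref(P)\<close>
  decreases as the word grows, so nothing is lost.
\<close>

text \<open>An order-reversing involution is an anti-automorphism of the lattice and so exchanges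
  joins and meets. This gives \<open>And\<close>, which is a negated disjunction, its expected
  value.\<close>

lemma demorgan_inf: "- (- x \<squnion> - y) = (x::'l::complete_de_morgan) \<sqinter> y"
proof (rule antisym)
  show "- (- x \<squnion> - y) \<le> x \<sqinter> y"
    using uminus_antitone[of "- x" "- x \<squnion> - y"] uminus_antitone[of "- y" "- x \<squnion> - y"]
    by (simp add: uminus_involutive)
  have "- x \<squnion> - y \<le> - (x \<sqinter> y)"
    by (simp add: uminus_antitone)
  then show "x \<sqinter> y \<le> - (- x \<squnion> - y)"
    using uminus_antitone[of "- x \<squnion> - y" "- (x \<sqinter> y)"] by (simp add: uminus_involutive)
qed

lemma form_val_And: "form_val (And \<psi>\<^sub>1 \<psi>\<^sub>2) \<Phi> = form_val \<psi>\<^sub>1 \<Phi> \<sqinter> form_val \<psi>\<^sub>2 \<Phi>"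
  by (simp add: And_def demorgan_inf)

lemma form_val_BigOr: "form_val (BigOr \<psi>s) \<Phi> = (\<Squnion>\<psi>\<in>set \<psi>s. form_val \<psi> \<Phi>)"
  by (induction \<psi>s rule: BigOr.induct) simp_all

text \<open>States of the product are labelled by singletons. On \<open>{q}\<close> every atom other
  than \<open>q\<close> is \<bottom>, so only the disjunct of \<open>q\<close> survives in the
  join.\<close>

lemma form_val_final_form:
  assumes "q \<in> set qs"
  shows "form_val (final_form F qs) {q} = F q"
proof -
  have "form_val (final_form F qs) {q} = (\<Squnion>p\<in>set qs. F p \<sqinter> (if p = q then \<top> else \<bottom>))"
    by (simp add: final_form_def form_val_BigOr form_val_And image_image)
  also have "\<dots> = F q"
    using assms by (intro antisym SUP_least SUP_upper2[of q]) auto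
  finally show ?thesis .
qed

lemma omega_words_iff: "w \<in> omega_words A \<longleftrightarrow> (\<forall>i. w i \<in> A)"
  by (auto simp: omega_words_def)

lemma conc_in_omega_words:
  assumes "\<theta> \<in> lists A" "\<tau> \<in> omega_words A"
  shows "\<theta> \<frown> \<tau> \<in> omega_words A"
  using assms by (auto simp: omega_words_def)

lemma prefix_in_lists:
  assumes "\<sigma> \<in> omega_words A"
  shows "prefix n \<sigma> \<in> lists A"
  using assms by (auto simp: omega_words_iff)

lemma suffix_in_omega_words:
  assumes "\<sigma> \<in> omega_words A"
  shows "suffix n \<sigma> \<in> omega_words A"
  using assms by (auto simp: omega_words_iff suffix_def)

text \<open>Prepending the segment of \<sigma> between \<open>m\<close> and \<open>n\<close> turns
  each continuation of the longer prefix into one of the shorter prefix, so the shorter prefix has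
  the larger join.\<close>

lemma GPref_prefix_antimono:
  assumes \<sigma>: "\<sigma> \<in> omega_words (Pow AP)" and "m \<le> n"
  shows "GPref AP P (prefix n \<sigma>) \<le> GPref AP P (prefix m \<sigma>)"
  unfolding GPref_def
proof (rule SUP_least)
  fix \<tau> :: "'a set word" assume \<tau>: "\<tau> \<in> omega_words (Pow AP)"
  have "prefix n \<sigma> = prefix m \<sigma> @ subsequence \<sigma> m n"
    using subsequence_append[of \<sigma> m "n - m"] \<open>m \<le> n\<close> by simp
  moreover have "subsequence \<sigma> m n \<in> lists (Pow AP)"
    using \<sigma> unfolding omega_words_iff in_lists_conv_set set_subsequence by blast
  ultimately show "P (prefix n \<sigma> \<frown> \<tau>) \<le> (\<Squnion>\<tau>\<in>omega_words (Pow AP). P (prefix m \<sigma> \<frown> \<tau>))"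
    using conc_in_omega_words[OF _ \<tau>] by (intro SUP_upper2[of "(subsequence \<sigma> m n) \<frown> \<tau>"]) auto
qed

text \<open>The remaining suffix of \<sigma> is one of the continuations over which the join
  ranges.\<close>

lemma Traces_le_Traces_fin_prefix:
  assumes "\<sigma> \<in> omega_words (Pow (props TS))"
  shows "Traces TS \<sigma> \<le> Traces_fin TS (prefix n \<sigma>)"
  unfolding Traces_fin_def
  using suffix_in_omega_words[OF assms, of n] by (intro SUP_upper2[of "suffix n \<sigma>"]) auto

text \<open>Index \<open>i\<close> means that the letters 0 to \<open>i\<close> have already been
  read, hence \<open>Suc i\<close>. This matches the product, whose initial states have already
  consumed the label of the first state.\<close>

definition run :: "('q, 'a, 'l) vdfa \<Rightarrow> 'a word \<Rightarrow> 'q word" where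
  "run A \<sigma> i = foldl (delta A) (start A) (prefix (Suc i) \<sigma>)"

lemma run_0: "run A \<sigma> 0 = delta A (start A) (\<sigma> 0)"
  by (simp add: run_def subsequence_def)

lemma run_Suc: "run A \<sigma> (Suc i) = delta A (run A \<sigma> i) (\<sigma> (Suc i))"
  by (simp add: run_def subsequence_def)

lemma final_val_run: "final_val A (run A \<sigma> i) = lang A (prefix (Suc i) \<sigma>)"
  by (simp add: run_def lang_def)

lemma run_in_vstates:
  assumes "is_vdfa A" "\<sigma> \<in> omega_words (alphabet A)"
  shows "run A \<sigma> i \<in> vstates A"
  using assms by (induction i) (auto simp: run_0 run_Suc is_vdfa_def omega_words_iff)

lemma label_comp_in_omega_words:
  assumes "is_mvts TS" "s \<in> omega_words (states TS)"
  shows "label TS \<circ> s \<in> omega_words (Pow (props TS))"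
  using assms by (simp add: is_mvts_def omega_words_iff image_subset_iff)

lemma product_simps [simp]:
  "states (TS \<otimes> A) = states TS \<times> vstates A"
  "actions (TS \<otimes> A) = actions TS"
  "trans_val (TS \<otimes> A) (s, q) \<alpha> (t, p) =
     (if delta A q (label TS t) = p then trans_val TS s \<alpha> t else \<bottom>)"
  "init_val (TS \<otimes> A) (s, q) = (if delta A (start A) (label TS s) = q then init_val TS s else \<bottom>)"
  "props (TS \<otimes> A) = vstates A"
  "label (TS \<otimes> A) (s, q) = {q}"
  by (simp_all add: product_def)

lemma is_mvts_product:
  assumes "is_mvts TS" "is_vdfa A"
  shows "is_mvts (TS \<otimes> A)"
  using assms by (auto simp: is_mvts_def is_vdfa_def)

text \<open>Along a run both conditionals in the product take their first branch, so the default
  \<bottom> never enters the meet.\<close>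

lemma exec_val_product_run:
  "exec_val (TS \<otimes> A) (\<lambda>i. (s i, run A (label TS \<circ> s) i), a) = exec_val TS (s, a)"
  by (simp add: run_0 run_Suc)

text \<open>Existence of the lift: labels are legal letters, so the run stays in
  \<open>vstates A\<close>, and the initial and transition values are those of \<open>TS\<close>,
  hence nonzero.\<close>

lemma product_execution_run:
  assumes "is_mvts TS" "is_vdfa A" "alphabet A = Pow (props TS)" "(s, a) \<in> executions TS"
  shows "(\<lambda>i. (s i, run A (label TS \<circ> s) i), a) \<in> executions (TS \<otimes> A)"
proof -
  have "run A (label TS \<circ> s) i \<in> vstates A" for i
    using assms by (intro run_in_vstates) (auto simp: executions_def intro: label_comp_in_omega_words)
  then show ?thesis
    using assms(4) by (auto simp: executions_def omega_words_iff run_0 run_Suc)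
qed

text \<open>Uniqueness of the lift: a product value is \<bottom> as soon as the automaton component
  departs from \<open>delta\<close>, whereas executions have only nonzero values. Induction thus
  forces that component to be the run.\<close>

lemma product_executionE:
  assumes "(sq, a) \<in> executions (TS \<otimes> A)"
  obtains s where "(s, a) \<in> executions TS" "sq = (\<lambda>i. (s i, run A (label TS \<circ> s) i))"
proof -
  define s where "s = fst \<circ> sq"
  define q where "q = snd \<circ> sq"
  have sq: "sq i = (s i, q i)" for i
    by (simp add: s_def q_def)
  have "sq i \<in> states TS \<times> vstates A" and acts: "a i \<in> actions TS" for i
    using assms by (simp_all add: executions_def omega_words_iff)
  then have states: "s i \<in> states TS" for i
    by (metis SigmaD1 sq)
  have init: "init_val (TS \<otimes> A) (s 0, q 0) > \<bottom>"
    and step: "trans_val (TS \<otimes> A) (s i, q i) (a i) (s (Suc i), q (Suc i)) > \<bottom>" for i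
    using assms unfolding executions_def mem_Collect_eq prod.case sq by blast+
  have q_eq: "q i = run A (label TS \<circ> s) i" for i
  proof (induction i)
    case 0
    show ?case using init by (auto simp: run_0 split: if_splits)
  next
    case (Suc i)
    show ?case using step[of i] Suc by (auto simp: run_Suc split: if_splits)
  qed
  have "init_val TS (s 0) > \<bottom>"
    using init by (simp split: if_splits)
  moreover have "trans_val TS (s i) (a i) (s (Suc i)) > \<bottom>" for i
    using step[of i] by (simp split: if_splits)
  ultimately have "(s, a) \<in> executions TS"
    using states acts by (auto simp: executions_def omega_words_iff)
  with sq q_eq show thesis
    by (intro that) auto
qed

text \<open>A join lies below a bound iff each of its members does, and every execution has its
  trace among the words over which \<open>satisfies\<close> quantifies.\<close>

lemma satisfies_iff_executions:
  assumes "is_mvts TS"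
  shows "TS \<Turnstile> P \<longleftrightarrow> (\<forall>(s, a)\<in>executions TS. exec_val TS (s, a) \<le> P (label TS \<circ> s))"
proof -
  have "label TS \<circ> s \<in> omega_words (Pow (props TS))" if "(s, a) \<in> executions TS" for s a
    using assms that by (auto simp: executions_def intro: label_comp_in_omega_words)
  then show ?thesis
    unfolding satisfies_def Traces_def SUP_le_iff exec_trace_def
    by (auto simp del: exec_val.simps)
qed

lemma product_satisfies_iff:
  assumes "is_mvts TS" "is_vdfa A" "alphabet A = Pow (props TS)" "set qs = vstates A"
  shows "TS \<otimes> A \<Turnstile> inv_prop (final_form (final_val A) qs) \<longleftrightarrow>
    (\<forall>(s, a)\<in>executions TS. \<forall>i. exec_val TS (s, a) \<le> lang A (prefix (Suc i) (label TS \<circ> s)))"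
    (is "?sat \<longleftrightarrow> ?R")
proof -
  let ?\<phi> = "final_form (final_val A) qs"
  \<comment> \<open>At time \<open>i\<close> the lift carries the singleton label of the state
    reached, so the formula evaluates to the final value there, which is \<open>lang A\<close> on
    the prefix read so far.\<close>
  have val: "inv_prop ?\<phi> (label (TS \<otimes> A) \<circ> (\<lambda>i. (s i, run A (label TS \<circ> s) i)))
      = (\<Sqinter>i. lang A (prefix (Suc i) (label TS \<circ> s)))"
    if "(s, a) \<in> executions TS" for s a
  proof -
    have "run A (label TS \<circ> s) i \<in> set qs" for i
      using assms that
      by (auto simp: executions_def intro!: run_in_vstates label_comp_in_omega_words)
    then show ?thesis
      by (simp add: inv_prop_def form_val_final_form final_val_run)
  qed
  have "?sat \<longleftrightarrow> (\<forall>(sq, a)\<in>executions (TS \<otimes> A).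
      exec_val (TS \<otimes> A) (sq, a) \<le> inv_prop ?\<phi> (label (TS \<otimes> A) \<circ> sq))"
    by (rule satisfies_iff_executions[OF is_mvts_product[OF assms(1,2)]])
  also have "\<dots> \<longleftrightarrow> (\<forall>(s, a)\<in>executions TS.
      exec_val TS (s, a) \<le> (\<Sqinter>i. lang A (prefix (Suc i) (label TS \<circ> s))))"
    (is "?L \<longleftrightarrow> ?M")
  proof
    assume L: ?L
    show ?M
    proof clarify
      fix s a assume "(s, a) \<in> executions TS"
      \<comment> \<open>Both sides are rewritten backwards into values of the lift, to which
        \<open>?L\<close> applies.\<close>
      with product_execution_run[OF assms(1-3) this] L
      show "exec_val TS (s, a) \<le> (\<Sqinter>i. lang A (prefix (Suc i) (label TS \<circ> s)))"
        unfolding val[symmetric, OF \<open>(s, a) \<in> executions TS\<close>]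
          exec_val_product_run[of TS A s a, symmetric] by blast
    qed
  next
    assume M: ?M
    show ?L
    proof clarify
      fix sq a assume "(sq, a) \<in> executions (TS \<otimes> A)"
      then obtain s where s: "(s, a) \<in> executions TS"
        and sq: "sq = (\<lambda>i. (s i, run A (label TS \<circ> s) i))"
        by (rule product_executionE)
      show "exec_val (TS \<otimes> A) (sq, a) \<le> inv_prop ?\<phi> (label (TS \<otimes> A) \<circ> sq)"
        unfolding sq exec_val_product_run val[OF s] using M s by blast
    qed
  qed
  finally show ?thesis
    by (simp only: le_INF_iff) auto
qed

theorem theorem2:
  fixes TS :: "('s, 'act, 'p, 'l::complete_de_morgan) mvts"
    and P :: "'p set word \<Rightarrow> 'l"
    and A :: "('q, 'p set, 'l) vdfa"
    and qs :: "'q list"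
  assumes "is_mvts TS"
    and "no_terminal_states TS"
    and "safety (props TS) P"
    and "is_vdfa A"
    and "alphabet A = Pow (props TS)"
    and "\<forall>\<theta>\<in>lists (Pow (props TS)). lang A \<theta> = GPref (props TS) P \<theta>"
    and "set qs = vstates A" and "distinct qs"
  shows "(TS \<Turnstile> P \<longleftrightarrow> (\<forall>\<theta>\<in>lists (Pow (props TS)). Traces_fin TS \<theta> \<le> lang A \<theta>)) \<and>
         ((\<forall>\<theta>\<in>lists (Pow (props TS)). Traces_fin TS \<theta> \<le> lang A \<theta>) \<longleftrightarrow>
           TS \<otimes> A \<Turnstile> inv_prop (final_form (final_val A) qs))"
    (is "(?one \<longleftrightarrow> ?two) \<and> (?two \<longleftrightarrow> ?three)")
proof -
  let ?W = "omega_words (Pow (props TS))"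
  note product_iff = product_satisfies_iff[OF assms(1,4,5,7)]
  have trace: "label TS \<circ> s \<in> ?W" if "(s, a) \<in> executions TS" for s a
    using that assms(1) by (auto simp: executions_def intro: label_comp_in_omega_words)
  have lang: "lang A (prefix n \<sigma>) = GPref (props TS) P (prefix n \<sigma>)" if "\<sigma> \<in> ?W" for n \<sigma>
    using assms(6) prefix_in_lists[OF that] by blast
  have "?two" if "?one"
  proof
    fix \<theta> assume \<theta>: "\<theta> \<in> lists (Pow (props TS))"
    \<comment> \<open>Both joins range over the same continuations, so they compare term by
      term.\<close>
    have "Traces_fin TS \<theta> \<le> GPref (props TS) P \<theta>"
      unfolding Traces_fin_def GPref_def
      using that conc_in_omega_words[OF \<theta>] by (intro SUP_mono) (auto simp: satisfies_def)
    then show "Traces_fin TS \<theta> \<le> lang A \<theta>"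
      using assms(6) \<theta> by simp
  qed
  moreover have "?three" if "?two"
    unfolding product_iff
  proof clarify
    fix s a i assume sa: "(s, a) \<in> executions TS"
    \<comment> \<open>The value of an execution is bounded by that of its trace, and this by
      \<open>Traces_fin\<close> on each prefix of the trace.\<close>
    have "exec_val TS (s, a) \<le> Traces TS (label TS \<circ> s)"
      unfolding Traces_def using sa by (intro SUP_upper) (simp add: exec_trace_def)
    also have "\<dots> \<le> Traces_fin TS (prefix (Suc i) (label TS \<circ> s))"
      by (rule Traces_le_Traces_fin_prefix[OF trace[OF sa]])
    also have "\<dots> \<le> lang A (prefix (Suc i) (label TS \<circ> s))"
      using that prefix_in_lists[OF trace[OF sa]] by blast
    finally show "exec_val TS (s, a) \<le> lang A (prefix (Suc i) (label TS \<circ> s))" .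
  qed
  moreover have "?one" if "?three"
  proof -
    have "exec_val TS (s, a) \<le> P (label TS \<circ> s)" if sa: "(s, a) \<in> executions TS" for s a
    proof -
      let ?\<sigma> = "label TS \<circ> s"
      have "exec_val TS (s, a) \<le> GPref (props TS) P (prefix n ?\<sigma>)" for n
      proof -
        \<comment> \<open>\<open>?three\<close> bounds nonempty prefixes only; going through
          \<open>Suc n\<close> also reaches the empty prefix \<open>n = 0\<close>, which belongs to
          \<open>Pref ?\<sigma>\<close>.\<close>
        have "exec_val TS (s, a) \<le> GPref (props TS) P (prefix (Suc n) ?\<sigma>)"
          using \<open>?three\<close> sa unfolding product_iff lang[OF trace[OF sa], symmetric] by blast
        also have "\<dots> \<le> GPref (props TS) P (prefix n ?\<sigma>)"
          by (rule GPref_prefix_antimono[OF trace[OF sa]]) simp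
        finally show ?thesis .
      qed
      then have "exec_val TS (s, a) \<le> (\<Sqinter>\<theta>\<in>Pref ?\<sigma>. GPref (props TS) P \<theta>)"
        by (intro INF_greatest) (auto simp: Pref_def simp del: exec_val.simps)
      \<comment> \<open>Safety turns the bounds at all finite prefixes into a bound at the infinite
        trace.\<close>
      also have "\<dots> \<le> P ?\<sigma>"
        using assms(3) trace[OF sa] by (auto simp: safety_def)
      finally show ?thesis .
    qed
    then show ?thesis
      unfolding satisfies_iff_executions[OF assms(1)] by blast
  qed
  ultimately show ?thesis by blast
qed

end
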